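(* Let $(G,\sigma)$ be a signed graph and let $k$ be a positive integer. Then $(G,\sigma)$ is $0$-free $2k$-colorable if and only if $(G,\sigma)$ is circular $2k$-colorable.
   Context: A signed graph $(G,\sigma)$ is a (finite) graph $G$ (loops and multi-edges allowed) with a signature $\sigma:E(G)\to\{+,-\}$. A $0$-free $2k$-coloring of $(G,\sigma)$ is a map $f:V(G)\to\{\pm1,\pm2,\dots,\pm k\}$ such that $f(u)\ne\sigma(e)f(v)$ for every edge $e=uv$. For real $r\ge 1$, $C^r$ is the circle of circumference $r$ (points are $[0,r)$), $d_{(\mathrm{mod}\, r)}(x,y)$ is the length of the shorter arc of $C^r$ between $x$ and $y$, and the antipodal $\bar x$ of $x$ is the point at distance $r/2$ from $x$. A circular $r$-coloring of $(G,\sigma)$ is a map $f:V(G)\to C^r$ such that $d_{(\mathrm{mod}\, r)}(f(u),f(v))\ge 1$ for each positive edge $uv$ and $d_{(\mathrm{mod}\, r)}(f(u),\overline{f(v)})\ge 1$ for each negative edge $uv$. "Colorable" means a coloring of the respective kind exists. *)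

theory Defs
  imports Complex_Main "HOL-Library.Uprod"
begin

datatype sign = Plus | Minus

fun sign_val :: "sign \<Rightarrow> int" where
  "sign_val Plus = 1"
| "sign_val Minus = - 1"

text \<open>
  Edges have their own type, so parallel edges are distinct elements of \<open>edges G\<close>,
  possibly with different signs; the unordered pair \<open>Upair v v\<close> makes an edge a loop.
\<close>

record ('v, 'e) signed_graph =
  verts :: "'v set"
  edges :: "'e set"
  ends :: "'e \<Rightarrow> 'v uprod"
  sigma :: "'e \<Rightarrow> sign"

definition finite_signed_graph :: "('v, 'e) signed_graph \<Rightarrow> bool" where
  "finite_signed_graph G \<longleftrightarrow>
     finite (verts G) \<and> finite (edges G) \<and> (\<forall>e\<in>edges G. set_uprod (ends G e) \<subseteq> verts G)"

text \<open>The parameter \<open>k\<close> is half the number of colors.\<close>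

definition zero_free_2k_coloring :: "('v, 'e) signed_graph \<Rightarrow> nat \<Rightarrow> ('v \<Rightarrow> int) \<Rightarrow> bool" where
  "zero_free_2k_coloring G k f \<longleftrightarrow>
     (\<forall>v\<in>verts G. f v \<in> {- int k..int k} - {0}) \<and>
     (\<forall>e\<in>edges G. \<forall>u v. ends G e = Upair u v \<longrightarrow> f u \<noteq> sign_val (sigma G e) * f v)"

definition zero_free_2k_colorable :: "('v, 'e) signed_graph \<Rightarrow> nat \<Rightarrow> bool" where
  "zero_free_2k_colorable G k \<longleftrightarrow> (\<exists>f. zero_free_2k_coloring G k f)"

definition circle :: "real \<Rightarrow> real set" where
  "circle r = {0..<r}"

text \<open>
  Two points \<open>x\<close> and \<open>y\<close> of \<open>circle r\<close> bound one arc of length \<open>\<bar>x - y\<bar>\<close> and one of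
  length \<open>r - \<bar>x - y\<bar>\<close>.
\<close>

definition circ_dist :: "real \<Rightarrow> real \<Rightarrow> real \<Rightarrow> real" where
  "circ_dist r x y = min \<bar>x - y\<bar> (r - \<bar>x - y\<bar>)"

definition antipodal :: "real \<Rightarrow> real \<Rightarrow> real" where
  "antipodal r x = (THE y. y \<in> circle r \<and> circ_dist r x y = r / 2)"

lemma antipodal_eq:
  assumes "x \<in> circle r"
  shows "antipodal r x = (if x < r / 2 then x + r / 2 else x - r / 2)"
  unfolding antipodal_def
proof (rule the_equality)
  show "(if x < r / 2 then x + r / 2 else x - r / 2) \<in> circle r \<and>
        circ_dist r x (if x < r / 2 then x + r / 2 else x - r / 2) = r / 2"
    using assms by (auto simp: circle_def circ_dist_def)
next
  fix y assume "y \<in> circle r \<and> circ_dist r x y = r / 2"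
  then show "y = (if x < r / 2 then x + r / 2 else x - r / 2)"
    using assms by (auto simp: circle_def circ_dist_def min_def abs_if split: if_splits)
qed

text \<open>Meant for \<open>r \<ge> 1\<close>.\<close>

definition circular_coloring :: "('v, 'e) signed_graph \<Rightarrow> real \<Rightarrow> ('v \<Rightarrow> real) \<Rightarrow> bool" where
  "circular_coloring G r f \<longleftrightarrow>
     (\<forall>v\<in>verts G. f v \<in> circle r) \<and>
     (\<forall>e\<in>edges G. \<forall>u v. ends G e = Upair u v \<longrightarrow>
        (sigma G e = Plus \<longrightarrow> circ_dist r (f u) (f v) \<ge> 1) \<and>
        (sigma G e = Minus \<longrightarrow> circ_dist r (f u) (antipodal r (f v)) \<ge> 1))"

definition circular_colorable :: "('v, 'e) signed_graph \<Rightarrow> real \<Rightarrow> bool" where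
  "circular_colorable G r \<longleftrightarrow> (\<exists>f. circular_coloring G r f)"

end

theory Submission
  imports Defs
begin

text \<open>
  Rounding down the values of a circular \<open>2k\<close>-coloring puts all colors on the integer points
  \<open>0, \<dots>, 2k - 1\<close> of the circle. Points with equal floor are at distance less than 1, and rounding
  commutes with the antipodal map because the shift by \<open>k\<close> is an integer; so a rounded coloring
  keeps the ends of every edge apart. The integer points, with the antipodal map, are a copy of the
  colors \<open>\<plusminus>1, \<dots>, \<plusminus>k\<close> with negation, and distinct integer points are at distance at least 1.
\<close>

text \<open>Colors \<open>1, ..., k\<close> fill the first half of the circle in order and
  \<open>-1, ..., -k\<close> the second half, so that negating a color shifts its point by
  \<open>k\<close>, half the circumference.\<close>

definition circle_point :: "nat \<Rightarrow> int \<Rightarrow> int" where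
  "circle_point k i = (if i > 0 then i - 1 else int k - i - 1)"

text \<open>The inverse of \<open>circle_point\<close>, from the points
  \<open>0, ..., 2k - 1\<close> to the nonzero colors.\<close>

definition point_color :: "nat \<Rightarrow> int \<Rightarrow> int" where
  "point_color k m = (if m < int k then m + 1 else int k - m - 1)"

lemma circle_point_in_circle:
  assumes "i \<in> {- int k..int k} - {0}"
  shows "of_int (circle_point k i) \<in> circle (2 * real k)"
proof -
  have "0 \<le> circle_point k i" "circle_point k i < 2 * int k"
    using assms by (auto simp: circle_point_def)
  then show ?thesis
    by (simp add: circle_def)
qed

lemma antipodal_circle_point:
  assumes "i \<in> {- int k..int k} - {0}"
  shows "antipodal (2 * real k) (of_int (circle_point k i)) = of_int (circle_point k (- i))"
proof -
  \<comment> \<open>The sign of \<open>i\<close> thus selects the branch of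
    \<open>antipodal_eq\<close>, as half the circumference is \<open>k\<close>.\<close>
  have "real_of_int (circle_point k i) < real k \<longleftrightarrow> circle_point k i < int k"
    by linarith
  also have "\<dots> \<longleftrightarrow> i > 0"
    using assms by (auto simp: circle_point_def)
  finally show ?thesis
    using assms unfolding antipodal_eq[OF circle_point_in_circle[OF assms]]
    by (auto simp: circle_point_def)
qed

text \<open>Distinct integers in \<open>0, ..., 2k - 1\<close> differ by at least 1 and at most
  \<open>2k - 1\<close>, so both arcs between them have length at least 1.\<close>

lemma circ_dist_circle_point_ge_1:
  assumes "i \<in> {- int k..int k} - {0}" "j \<in> {- int k..int k} - {0}" "i \<noteq> j"
  shows "circ_dist (2 * real k) (of_int (circle_point k i)) (of_int (circle_point k j)) \<ge> 1"
proof -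
  have "1 \<le> \<bar>circle_point k i - circle_point k j\<bar>"
    "\<bar>circle_point k i - circle_point k j\<bar> \<le> 2 * int k - 1"
    using assms by (auto simp: circle_point_def)
  then have "1 \<le> \<bar>real_of_int (circle_point k i) - of_int (circle_point k j)\<bar>"
    "\<bar>real_of_int (circle_point k i) - of_int (circle_point k j)\<bar> \<le> 2 * real k - 1"
    by linarith+
  then show ?thesis
    by (simp add: circ_dist_def)
qed

lemma floor_neq_if_circ_dist_ge_1:
  assumes "circ_dist r x y \<ge> 1"
  shows "\<lfloor>x\<rfloor> \<noteq> \<lfloor>y\<rfloor>"
proof
  assume "\<lfloor>x\<rfloor> = \<lfloor>y\<rfloor>"
  then have "\<bar>x - y\<bar> < 1"
    by linarith
  with assms show False
    by (simp add: circ_dist_def)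
qed

lemma point_color_range:
  assumes "x \<in> circle (2 * real k)"
  shows "point_color k \<lfloor>x\<rfloor> \<in> {- int k..int k} - {0}"
proof -
  have "0 \<le> \<lfloor>x\<rfloor>" "\<lfloor>x\<rfloor> < 2 * int k"
    using assms by (auto simp: circle_def floor_less_iff)
  then show ?thesis
    \<comment> \<open>As a simp rule, \<open>zero_le_floor\<close> would turn the integer bound on
      the floor into a real bound on \<open>x\<close>.\<close>
    by (auto simp: point_color_def simp del: zero_le_floor)
qed

text \<open>This left inverse ensures that different floors receive different colors.\<close>

lemma circle_point_point_color:
  assumes "x \<in> circle (2 * real k)"
  shows "circle_point k (point_color k \<lfloor>x\<rfloor>) = \<lfloor>x\<rfloor>"
  using assms by (auto simp: circle_def circle_point_def point_color_def)

text \<open>Since \<open>k\<close> is an integer, the floor of \<open>x\<close> decides which half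
  of the circle contains \<open>x\<close>, and a shift by \<open>k\<close> commutes with
  rounding.\<close>

lemma circle_point_uminus_point_color:
  assumes "x \<in> circle (2 * real k)"
  shows "circle_point k (- point_color k \<lfloor>x\<rfloor>) = \<lfloor>antipodal (2 * real k) x\<rfloor>"
proof -
  have "x < real k \<longleftrightarrow> \<lfloor>x\<rfloor> < int k"
    by (simp add: floor_less_iff)
  moreover have "\<lfloor>x + real k\<rfloor> = \<lfloor>x\<rfloor> + int k" "\<lfloor>x - real k\<rfloor> = \<lfloor>x\<rfloor> - int k"
    by linarith+
  moreover have "0 \<le> \<lfloor>x\<rfloor>"
    using assms by (simp add: circle_def)
  ultimately show ?thesis
    by (auto simp: antipodal_eq[OF assms] circle_point_def point_color_def
      simp del: zero_le_floor)
qed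

lemma ends_in_verts:
  assumes "finite_signed_graph G" "e \<in> edges G" "ends G e = Upair u v"
  shows "u \<in> verts G" "v \<in> verts G"
  using assms unfolding finite_signed_graph_def by force+

lemma circular_coloring_circle_point:
  assumes "finite_signed_graph G" and f: "zero_free_2k_coloring G k f"
  shows "circular_coloring G (2 * real k) (\<lambda>v. of_int (circle_point k (f v)))"
  unfolding circular_coloring_def
proof (intro conjI ballI allI impI)
  fix v assume "v \<in> verts G"
  with f show "of_int (circle_point k (f v)) \<in> circle (2 * real k)"
    unfolding zero_free_2k_coloring_def by (blast intro: circle_point_in_circle)
next
  fix e u v assume e: "e \<in> edges G" "ends G e = Upair u v"
  have range: "f u \<in> {- int k..int k} - {0}" "f v \<in> {- int k..int k} - {0}"
    using f ends_in_verts[OF assms(1) e] unfolding zero_free_2k_coloring_def by blast+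
  have neq: "f u \<noteq> sign_val (sigma G e) * f v"
    using f e unfolding zero_free_2k_coloring_def by blast
  show "circ_dist (2 * real k) (of_int (circle_point k (f u))) (of_int (circle_point k (f v))) \<ge> 1"
    if "sigma G e = Plus"
    using circ_dist_circle_point_ge_1[OF range] neq that by simp
  \<comment> \<open>The antipode of the point of \<open>f v\<close> is the point of this
    color.\<close>
  have "- f v \<in> {- int k..int k} - {0}"
    using range by auto
  then show "circ_dist (2 * real k) (of_int (circle_point k (f u)))
      (antipodal (2 * real k) (of_int (circle_point k (f v)))) \<ge> 1" if "sigma G e = Minus"
    using circ_dist_circle_point_ge_1[OF range(1)] neq that
    by (simp add: antipodal_circle_point[OF range(2)])
qed

lemma zero_free_2k_coloring_point_color:
  assumes "finite_signed_graph G" and f: "circular_coloring G (2 * real k) f"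
  shows "zero_free_2k_coloring G k (\<lambda>v. point_color k \<lfloor>f v\<rfloor>)"
  unfolding zero_free_2k_coloring_def
proof (intro conjI ballI allI impI)
  fix v assume "v \<in> verts G"
  with f show "point_color k \<lfloor>f v\<rfloor> \<in> {- int k..int k} - {0}"
    by (intro point_color_range) (simp add: circular_coloring_def)
next
  fix e u v assume e: "e \<in> edges G" "ends G e = Upair u v"
  have range: "f u \<in> circle (2 * real k)" "f v \<in> circle (2 * real k)"
    using f ends_in_verts[OF assms(1) e] unfolding circular_coloring_def by blast+
  show "point_color k \<lfloor>f u\<rfloor> \<noteq> sign_val (sigma G e) * point_color k \<lfloor>f v\<rfloor>"
  proof (cases "sigma G e")
    case Plus
    then have "\<lfloor>f u\<rfloor> \<noteq> \<lfloor>f v\<rfloor>"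
      using f e by (intro floor_neq_if_circ_dist_ge_1[of "2 * real k"]) (simp add: circular_coloring_def)
    with Plus show ?thesis
      using range circle_point_point_color by (metis mult_1 sign_val.simps(1))
  next
    case Minus
    then have "\<lfloor>f u\<rfloor> \<noteq> \<lfloor>antipodal (2 * real k) (f v)\<rfloor>"
      using f e by (intro floor_neq_if_circ_dist_ge_1[of "2 * real k"]) (simp add: circular_coloring_def)
    \<comment> \<open>If the two colors were opposite, applying \<open>circle_point\<close> would
      make these floors equal.\<close>
    with Minus show ?thesis
      using range circle_point_point_color circle_point_uminus_point_color
      by (metis mult_minus1 sign_val.simps(2))
  qed
qed

theorem proposition1p4:
  fixes G :: "('v, 'e) signed_graph" and k :: nat
  assumes "finite_signed_graph G"
    and "k \<ge> 1"
  shows "zero_free_2k_colorable G k \<longleftrightarrow> circular_colorable G (2 * real k)"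
  using circular_coloring_circle_point[OF assms(1)] zero_free_2k_coloring_point_color[OF assms(1)]
  unfolding zero_free_2k_colorable_def circular_colorable_def by blast

end
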